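(* Let $\mathcal{H}:=\ell^2(\mathbb{Z})$ be the real Hilbert space of square summable real sequences $(a_n)_{n\in\mathbb{Z}}$. There exists a smooth (i.e., $C^\infty$) vector field $f\colon\mathcal{H}\to\mathcal{H}$ such that the ordinary differential equation $x'=f(x)$ has a bounded maximal solution $\gamma\colon\,]a,b[\,\to\mathcal{H}$ which is not globally defined, i.e., $]a,b[\,\neq\mathbb{R}$.
   Context: $]a,b[$ denotes an open interval with $-\infty\le a<b\le\infty$. A solution of $x'=f(x)$ is a differentiable curve $\gamma\colon\,]a,b[\,\to\mathcal{H}$ with $\gamma'(t)=f(\gamma(t))$ for all $t\in\,]a,b[$; it is maximal if it cannot be extended to a solution on a strictly larger open interval. Bounded means that the image $\gamma(]a,b[)$ is a norm-bounded subset of $\mathcal{H}$. Smoothness of maps between Banach spaces is in the usual (Fréchet) sense. *)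

theory Defs
  imports "HOL-Analysis.Analysis"
begin

definition square_summable :: "('i \<Rightarrow> real) \<Rightarrow> bool" where
  "square_summable a \<longleftrightarrow> (\<lambda>i. (a i)\<^sup>2) summable_on UNIV"

typedef 'i ell2 = "{a :: 'i \<Rightarrow> real. square_summable a}"
  morphisms coord Abs_ell2
  by (rule exI[of _ "\<lambda>_. 0"]) (simp add: square_summable_def)

setup_lifting type_definition_ell2

lemma square_summable_add:
  assumes "square_summable a" "square_summable b"
  shows "square_summable (\<lambda>i. a i + b i)"
  unfolding square_summable_def
proof (rule summable_on_comparison_test)
  show "(\<lambda>i. 2 * (a i)\<^sup>2 + 2 * (b i)\<^sup>2) summable_on UNIV"
    using assms unfolding square_summable_def
    by (intro summable_on_add summable_on_cmult_right)
  show "(a i + b i)\<^sup>2 \<le> 2 * (a i)\<^sup>2 + 2 * (b i)\<^sup>2" for i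
    using sum_squares_bound[of "a i" "b i"] by (simp add: power2_sum)
qed simp

lemma square_summable_scale:
  assumes "square_summable a"
  shows "square_summable (\<lambda>i. r * a i)"
  using summable_on_cmult_right[of "\<lambda>i. (a i)\<^sup>2" UNIV "r\<^sup>2"] assms
  by (simp add: square_summable_def power_mult_distrib)

lemma square_summable_mult_summable:
  assumes "square_summable a" "square_summable b"
  shows "(\<lambda>i. a i * b i) summable_on UNIV"
proof -
  have "(\<lambda>i. norm (a i * b i)) summable_on UNIV"
  proof (rule summable_on_comparison_test)
    show "(\<lambda>i. (a i)\<^sup>2 + (b i)\<^sup>2) summable_on UNIV"
      using assms unfolding square_summable_def by (rule summable_on_add)
    show "norm (a i * b i) \<le> (a i)\<^sup>2 + (b i)\<^sup>2" for i
    proof -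
      have "2 * \<bar>a i * b i\<bar> \<le> (a i)\<^sup>2 + (b i)\<^sup>2"
        using sum_squares_bound[of "\<bar>a i\<bar>" "\<bar>b i\<bar>"] by (simp add: abs_mult)
      then show ?thesis by simp
    qed
  qed simp
  then show ?thesis by (rule abs_summable_summable)
qed

instantiation ell2 :: (type) real_vector
begin

lift_definition zero_ell2 :: "'a ell2" is "\<lambda>_. 0"
  by (simp add: square_summable_def)

lift_definition plus_ell2 :: "'a ell2 \<Rightarrow> 'a ell2 \<Rightarrow> 'a ell2" is "\<lambda>a b i. a i + b i"
  by (rule square_summable_add)

lift_definition uminus_ell2 :: "'a ell2 \<Rightarrow> 'a ell2" is "\<lambda>a i. - a i"
  by (simp add: square_summable_def)

lift_definition minus_ell2 :: "'a ell2 \<Rightarrow> 'a ell2 \<Rightarrow> 'a ell2" is "\<lambda>a b i. a i - b i"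
  subgoal for a b
    using square_summable_add[of a "\<lambda>i. - b i"] by (simp add: square_summable_def)
  done

lift_definition scaleR_ell2 :: "real \<Rightarrow> 'a ell2 \<Rightarrow> 'a ell2" is "\<lambda>r a i. r * a i"
  by (rule square_summable_scale)

instance
  by standard (transfer; simp add: algebra_simps fun_eq_iff)+

end

instantiation ell2 :: (type) real_inner
begin

lift_definition inner_ell2 :: "'a ell2 \<Rightarrow> 'a ell2 \<Rightarrow> real" is
  "\<lambda>a b. \<Sum>\<^sub>\<infinity>i. a i * b i" .

definition norm_ell2 :: "'a ell2 \<Rightarrow> real" where
  "norm_ell2 x = sqrt (inner x x)"

definition dist_ell2 :: "'a ell2 \<Rightarrow> 'a ell2 \<Rightarrow> real" where
  "dist_ell2 x y = norm (x - y)"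

definition sgn_ell2 :: "'a ell2 \<Rightarrow> 'a ell2" where
  "sgn_ell2 x = x /\<^sub>R norm x"

definition uniformity_ell2 :: "('a ell2 \<times> 'a ell2) filter" where
  "uniformity_ell2 = (INF e\<in>{0<..}. principal {(x, y). dist x y < e})"

definition open_ell2 :: "'a ell2 set \<Rightarrow> bool" where
  "open_ell2 U \<longleftrightarrow> (\<forall>x\<in>U. eventually (\<lambda>(x', y). x' = x \<longrightarrow> y \<in> U) uniformity)"

instance
proof
  fix x y z :: "'a ell2" and r :: real and U :: "'a ell2 set"
  show "dist x y = norm (x - y)" by (rule dist_ell2_def)
  show "sgn x = x /\<^sub>R norm x" by (rule sgn_ell2_def)
  show "(uniformity :: ('a ell2 \<times> 'a ell2) filter) = (INF e\<in>{0<..}. principal {(x, y). dist x y < e})"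
    by (rule uniformity_ell2_def)
  show "open U \<longleftrightarrow> (\<forall>x\<in>U. eventually (\<lambda>(x', y). x' = x \<longrightarrow> y \<in> U) uniformity)"
    by (rule open_ell2_def)
  show "norm x = sqrt (inner x x)" by (rule norm_ell2_def)
  show "inner x y = inner y x"
    by transfer (simp add: mult.commute)
  show "inner (x + y) z = inner x z + inner y z"
    by transfer (simp add: distrib_right infsum_add square_summable_mult_summable)
  show "inner (r *\<^sub>R x) y = r * inner x y"
    by transfer (simp add: mult.assoc infsum_cmult_right')
  show "0 \<le> inner x x"
    by transfer (simp add: infsum_nonneg)
  show "inner x x = 0 \<longleftrightarrow> x = 0"
  proof
    assume "inner x x = 0"
    then show "x = 0"
    proof transfer
      fix a :: "'a \<Rightarrow> real"
      assume "square_summable a" "(\<Sum>\<^sub>\<infinity>i. a i * a i) = 0"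
      then have "a i * a i = 0" for i
        by (intro nonneg_infsum_le_0D[of "\<lambda>i. a i * a i" UNIV])
           (auto intro: square_summable_mult_summable)
      then show "a = (\<lambda>_. 0)" by auto
    qed
  qed (transfer, simp)
qed

end

lemma sum_coord_square_le:
  assumes "finite F"
  shows "(\<Sum>i\<in>F. (coord x i)\<^sup>2) \<le> (norm x)\<^sup>2"
proof -
  have "(\<lambda>i. coord x i * coord x i) summable_on UNIV"
    using coord[of x] by (intro square_summable_mult_summable) auto
  then show ?thesis
    using assms finite_sum_le_infsum[of "\<lambda>i. coord x i * coord x i" UNIV F]
    by (simp add: power2_norm_eq_inner inner_ell2.rep_eq flip: power2_eq_square)
qed

lemma abs_coord_le: "\<bar>coord x i\<bar> \<le> norm x"
proof -
  have "(coord x i)\<^sup>2 \<le> (norm x)\<^sup>2"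
    using sum_coord_square_le[of "{i}" x] by simp
  then have "\<bar>coord x i\<bar> \<le> \<bar>norm x\<bar>"
    by (simp only: abs_le_square_iff)
  then show ?thesis by simp
qed

instance ell2 :: (type) complete_space
proof
  fix X :: "nat \<Rightarrow> 'a ell2"
  assume X: "Cauchy X"
  define L where "L i = lim (\<lambda>n. coord (X n) i)" for i
  have L: "(\<lambda>n. coord (X n) i) \<longlonglongrightarrow> L i" for i
  proof -
    have "Cauchy (\<lambda>n. coord (X n) i)"
    proof (rule metric_CauchyI)
      fix e :: real assume "0 < e"
      then obtain N where N: "\<forall>m\<ge>N. \<forall>n\<ge>N. dist (X m) (X n) < e"
        using metric_CauchyD[OF X] by blast
      have "dist (coord (X m) i) (coord (X n) i) < e" if "m \<ge> N" "n \<ge> N" for m n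
      proof -
        have "dist (coord (X m) i) (coord (X n) i) \<le> dist (X m) (X n)"
          using abs_coord_le[of "X m - X n" i] by (simp add: dist_norm minus_ell2.rep_eq)
        then show ?thesis using N that by (meson le_less_trans)
      qed
      then show "\<exists>N. \<forall>m\<ge>N. \<forall>n\<ge>N. dist (coord (X m) i) (coord (X n) i) < e" by blast
    qed
    then show ?thesis
      unfolding L_def by (meson Cauchy_convergent convergent_LIMSEQ_iff)
  qed
  have tail: "\<exists>N. \<forall>n\<ge>N. \<forall>F. finite F \<longrightarrow> (\<Sum>i\<in>F. (coord (X n) i - L i)\<^sup>2) \<le> e\<^sup>2"
    if "e > 0" for e :: real
  proof -
    obtain N where N: "\<forall>m\<ge>N. \<forall>n\<ge>N. dist (X m) (X n) < e"
      using metric_CauchyD[OF X \<open>e > 0\<close>] by blast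
    have "(\<Sum>i\<in>F. (coord (X n) i - L i)\<^sup>2) \<le> e\<^sup>2" if "n \<ge> N" "finite F" for n F
    proof (rule LIMSEQ_le_const2)
      show "(\<lambda>m. \<Sum>i\<in>F. (coord (X n) i - coord (X m) i)\<^sup>2) \<longlonglongrightarrow> (\<Sum>i\<in>F. (coord (X n) i - L i)\<^sup>2)"
        by (intro tendsto_intros L)
      have "(\<Sum>i\<in>F. (coord (X n) i - coord (X m) i)\<^sup>2) \<le> e\<^sup>2" if "m \<ge> N" for m
      proof -
        have "(\<Sum>i\<in>F. (coord (X n) i - coord (X m) i)\<^sup>2) \<le> (norm (X n - X m))\<^sup>2"
          using sum_coord_square_le[OF \<open>finite F\<close>, of "X n - X m"] by (simp add: minus_ell2.rep_eq)
        also have "\<dots> \<le> e\<^sup>2"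
          using N \<open>n \<ge> N\<close> \<open>m \<ge> N\<close> by (intro power_mono) (auto simp: dist_norm less_imp_le)
        finally show ?thesis .
      qed
      then show "\<exists>N. \<forall>m\<ge>N. (\<Sum>i\<in>F. (coord (X n) i - coord (X m) i)\<^sup>2) \<le> e\<^sup>2" by blast
    qed
    then show ?thesis by blast
  qed
  have sq: "square_summable (\<lambda>i. coord (X n) i - L i)"
    if "\<forall>F. finite F \<longrightarrow> (\<Sum>i\<in>F. (coord (X n) i - L i)\<^sup>2) \<le> C" for n C
    unfolding square_summable_def
  proof (rule nonneg_bdd_above_summable_on)
    show "bdd_above (sum (\<lambda>i. (coord (X n) i - L i)\<^sup>2) ` {F. F \<subseteq> UNIV \<and> finite F})"
      using that by (intro bdd_aboveI2[of _ _ C]) blast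
  qed simp
  obtain M where M: "\<forall>F. finite F \<longrightarrow> (\<Sum>i\<in>F. (coord (X M) i - L i)\<^sup>2) \<le> 1\<^sup>2"
    using tail[OF zero_less_one] by blast
  have "square_summable (\<lambda>i. coord (X M) i + (-1) * (coord (X M) i - L i))"
    using coord[of "X M"] by (intro square_summable_add square_summable_scale sq[OF M]) simp
  then have "square_summable L" by simp
  then obtain l where l: "coord l = L"
    using Abs_ell2_inverse[of L] by simp
  have "X \<longlonglongrightarrow> l"
  proof (rule metric_LIMSEQ_I)
    fix e :: real assume "0 < e"
    then obtain N where N: "\<forall>n\<ge>N. \<forall>F. finite F \<longrightarrow> (\<Sum>i\<in>F. (coord (X n) i - L i)\<^sup>2) \<le> (e / 2)\<^sup>2"
      using tail[of "e / 2"] half_gt_zero by blast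
    have "dist (X n) l < e" if "n \<ge> N" for n
    proof -
      have "(norm (X n - l))\<^sup>2 = (\<Sum>\<^sub>\<infinity>i. (coord (X n) i - L i)\<^sup>2)"
        by (simp add: power2_norm_eq_inner inner_ell2.rep_eq minus_ell2.rep_eq l flip: power2_eq_square)
      also have "\<dots> \<le> (e / 2)\<^sup>2"
      proof (rule infsum_le_finite_sums)
        show "(\<lambda>i. (coord (X n) i - L i)\<^sup>2) summable_on UNIV"
          using sq[of n "(e / 2)\<^sup>2"] N that unfolding square_summable_def by blast
      qed (use N that in blast)
      finally have "norm (X n - l) \<le> e / 2"
        by (rule power2_le_imp_le) (use \<open>0 < e\<close> in simp)
      then show ?thesis using \<open>0 < e\<close> by (simp add: dist_norm)
    qed
    then show "\<exists>N. \<forall>n\<ge>N. dist (X n) l < e" by blast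
  qed
  then show "convergent X" by (rule convergentI)
qed

definition bounded_multilinear ::
    "nat \<Rightarrow> ('a::real_normed_vector list \<Rightarrow> 'b::real_normed_vector) \<Rightarrow> bool" where
  "bounded_multilinear n M \<longleftrightarrow>
     (\<forall>hs i. length hs = n \<and> i < n \<longrightarrow> linear (\<lambda>h. M (hs[i := h]))) \<and>
     (\<exists>K. \<forall>hs. length hs = n \<longrightarrow> norm (M hs) \<le> K * prod_list (map norm hs))"

text \<open>
  The iterated Frechet derivatives of a map from \<open>E\<close> to \<open>F\<close> live in the spaces
  \<open>L(E, L(E, \<dots>, F))\<close>, which form no single HOL type.  Under the usual isometric identification
  of these spaces with the bounded \<open>n\<close>-linear maps under the operator norm, \<open>D n x\<close> below is the
  \<open>n\<close>-th derivative at \<open>x\<close>, applied to lists of \<open>n\<close> directions; the head of the list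
  is the direction of the outermost derivative.  The last conjunct is Frechet differentiability of
  \<open>D n\<close> with derivative \<open>D (Suc n)\<close>, with the remainder estimated in the operator norm,
  i.e. uniformly in \<open>hs\<close>.
\<close>

definition smooth_map :: "('a::real_normed_vector \<Rightarrow> 'b::real_normed_vector) \<Rightarrow> bool" where
  "smooth_map f \<longleftrightarrow>
     (\<exists>D :: nat \<Rightarrow> 'a \<Rightarrow> 'a list \<Rightarrow> 'b.
        (\<forall>x. D 0 x [] = f x) \<and>
        (\<forall>n x. bounded_multilinear n (D n x)) \<and>
        (\<forall>n x. \<forall>e>0. \<exists>d>0. \<forall>h. norm h < d \<longrightarrow>
           (\<forall>hs. length hs = n \<longrightarrow>
              norm (D n (x + h) hs - D n x hs - D (Suc n) x (h # hs))
                \<le> e * norm h * prod_list (map norm hs))))"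

text \<open>
  A curve on the open interval from \<open>a\<close> to \<open>b\<close> is represented by a total function whose values
  off the interval are irrelevant.
\<close>

definition is_solution ::
    "('a::real_normed_vector \<Rightarrow> 'a) \<Rightarrow> ereal \<Rightarrow> ereal \<Rightarrow> (real \<Rightarrow> 'a) \<Rightarrow> bool" where
  "is_solution f a b \<gamma> \<longleftrightarrow>
     a < b \<and> (\<forall>t\<in>einterval a b. (\<gamma> has_vector_derivative f (\<gamma> t)) (at t))"

definition maximal_solution ::
    "('a::real_normed_vector \<Rightarrow> 'a) \<Rightarrow> ereal \<Rightarrow> ereal \<Rightarrow> (real \<Rightarrow> 'a) \<Rightarrow> bool" where
  "maximal_solution f a b \<gamma> \<longleftrightarrow>
     is_solution f a b \<gamma> \<and>
     \<not> (\<exists>c d \<delta>. einterval a b \<subset> einterval c d \<and> is_solution f c d \<delta> \<and>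
          (\<forall>t\<in>einterval a b. \<delta> t = \<gamma> t))"

end

(*
  Coordinate 0 serves as a clock s with s' = s, so that s = exp t reaches 1 in finite time.  The
  interval [0, 1) of clock values is cut into slots of lengths 1/2, 1/4, 1/8, ...; during slot k the
  solution moves mass from e(k+1) to e(k+3) by a smooth step, while its coordinate k+2 is constantly 1.
  Hence the term of the vector field that drives slot k may be multiplied by a cutoff in the
  coordinate k+2 that vanishes below 1/2.  The coordinates of a point of l^2 tend to 0, so only
  finitely many cutoffs are nonzero near a given point and the field is smooth, although its speed is
  unbounded on bounded sets.  As s tends to 1 the solution runs through e(k+1) + e(k+2) for all k,
  so it stays bounded without converging and cannot be extended.
*)
theory Submission
  imports Defs
begin

section \<open>Jets of derivatives and locally finite sums\<close>

section \<open>Smooth maps\<close>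

text \<open>The body of \<open>smooth_map\<close> with its witness made explicit, so that the
  derivatives of given maps can be named and combined.\<close>

definition has_jet ::
    "('a::real_normed_vector \<Rightarrow> 'b::real_normed_vector) \<Rightarrow> (nat \<Rightarrow> 'a \<Rightarrow> 'a list \<Rightarrow> 'b) \<Rightarrow> bool" where
  "has_jet f D \<longleftrightarrow>
     (\<forall>x. D 0 x [] = f x) \<and>
     (\<forall>n x. bounded_multilinear n (D n x)) \<and>
     (\<forall>n x. \<forall>e>0. \<exists>d>0. \<forall>h. norm h < d \<longrightarrow>
        (\<forall>hs. length hs = n \<longrightarrow>
           norm (D n (x + h) hs - D n x hs - D (Suc n) x (h # hs))
             \<le> e * norm h * prod_list (map norm hs)))"

lemma smooth_map_iff_has_jet: "smooth_map f \<longleftrightarrow> (\<exists>D. has_jet f D)"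
  by (simp add: smooth_map_def has_jet_def)

lemma has_jet_0: "has_jet f D \<Longrightarrow> D 0 x [] = f x"
  by (simp add: has_jet_def)

lemma has_jet_multilinear: "has_jet f D \<Longrightarrow> bounded_multilinear n (D n x)"
  by (simp add: has_jet_def)

lemma has_jet_remainder:
  assumes "has_jet f D" "e > 0"
  obtains d where "d > 0"
    "\<And>h hs. norm h < d \<Longrightarrow> length hs = n \<Longrightarrow>
       norm (D n (x + h) hs - D n x hs - D (Suc n) x (h # hs)) \<le> e * norm h * prod_list (map norm hs)"
  using assms unfolding has_jet_def by meson

lemma prod_list_norm_nonneg: "0 \<le> prod_list (map norm hs)"
  by (induction hs) auto

lemma bounded_multilinear_sum:
  assumes "\<And>k. k \<in> J \<Longrightarrow> bounded_multilinear n (M k)"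
  shows "bounded_multilinear n (\<lambda>hs. \<Sum>k\<in>J. M k hs)"
  unfolding bounded_multilinear_def
proof (intro conjI allI impI)
  show "linear (\<lambda>h. \<Sum>k\<in>J. M k (hs[i := h]))" if "length hs = n \<and> i < n" for hs i
    using assms that by (intro linear_compose_sum) (auto simp: bounded_multilinear_def)
  obtain C where C: "\<And>k hs. k \<in> J \<Longrightarrow> length hs = n \<Longrightarrow> norm (M k hs) \<le> C k * prod_list (map norm hs)"
    using assms unfolding bounded_multilinear_def by metis
  have "norm (\<Sum>k\<in>J. M k hs) \<le> (\<Sum>k\<in>J. C k) * prod_list (map norm hs)" if "length hs = n" for hs
    unfolding sum_distrib_right using C that by (intro sum_norm_le) auto
  then show "\<exists>C. \<forall>hs. length hs = n \<longrightarrow> norm (\<Sum>k\<in>J. M k hs) \<le> C * prod_list (map norm hs)"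
    by blast
qed

lemma has_jet_sum_remainder:
  fixes F :: "'k \<Rightarrow> 'a::real_normed_vector \<Rightarrow> 'b::real_normed_vector"
    and D :: "'k \<Rightarrow> nat \<Rightarrow> 'a \<Rightarrow> 'a list \<Rightarrow> 'b"
  assumes jet: "\<And>k. k \<in> J \<Longrightarrow> has_jet (F k) (D k)" and "finite J" "e > 0"
  shows "\<exists>d>0. \<forall>h hs. norm h < d \<longrightarrow> length hs = n \<longrightarrow>
    norm ((\<Sum>k\<in>J. D k n (x + h) hs) - (\<Sum>k\<in>J. D k n x hs) - (\<Sum>k\<in>J. D k (Suc n) x (h # hs)))
      \<le> e * norm h * prod_list (map norm hs)"
  using \<open>finite J\<close> jet \<open>e > 0\<close>
proof (induction J arbitrary: e rule: finite_induct)
  case empty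
  then show ?case by (auto intro!: exI[of _ 1] mult_nonneg_nonneg prod_list_norm_nonneg)
next
  case (insert k J)
  have "e / 2 > 0" using insert.prems by simp
  obtain d1 where d1: "d1 > 0" "\<And>h hs. norm h < d1 \<Longrightarrow> length hs = n \<Longrightarrow>
      norm (D k n (x + h) hs - D k n x hs - D k (Suc n) x (h # hs)) \<le> e / 2 * norm h * prod_list (map norm hs)"
    using has_jet_remainder[OF insert.prems(1)[of k] \<open>e / 2 > 0\<close>, of n x] by blast
  obtain d2 where d2: "d2 > 0" "\<And>h hs. norm h < d2 \<Longrightarrow> length hs = n \<Longrightarrow>
      norm ((\<Sum>k\<in>J. D k n (x + h) hs) - (\<Sum>k\<in>J. D k n x hs) - (\<Sum>k\<in>J. D k (Suc n) x (h # hs)))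
        \<le> e / 2 * norm h * prod_list (map norm hs)"
    using insert.IH[OF insert.prems(1) \<open>e / 2 > 0\<close>] by blast
  show ?case
  proof (intro exI[of _ "min d1 d2"] conjI allI impI)
    fix h :: 'a and hs :: "'a list"
    assume h: "norm h < min d1 d2" and hs: "length hs = n"
    show "norm ((\<Sum>k\<in>insert k J. D k n (x + h) hs) - (\<Sum>k\<in>insert k J. D k n x hs)
        - (\<Sum>k\<in>insert k J. D k (Suc n) x (h # hs))) \<le> e * norm h * prod_list (map norm hs)"
      using norm_triangle_mono[OF d1(2)[of h hs] d2(2)[of h hs]] h hs insert.hyps
      by (simp add: algebra_simps)
  qed (use d1 d2 in simp)
qed

text \<open>Where \<open>D n\<close> vanishes on all of \<open>U\<close>, the remainder estimate
  reduces to a bound on \<open>D (Suc n) x\<close> with an arbitrary factor \<open>e\<close>, first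
  for small directions and then, by linearity in the head, for all directions.\<close>

lemma has_jet_vanishes:
  assumes jet: "has_jet f D" and "open U" and zero: "\<And>y. y \<in> U \<Longrightarrow> f y = 0"
    and "x \<in> U" "length hs = n"
  shows "D n x hs = 0"
  using assms(4,5)
proof (induction n arbitrary: x hs)
  case 0
  then show ?case using has_jet_0[OF jet] zero by simp
next
  case (Suc n)
  obtain h ks where hs: "hs = h # ks" "length ks = n"
    using Suc.prems by (cases hs) auto
  let ?P = "prod_list (map norm ks)"
  have "\<forall>hs i. length hs = Suc n \<and> i < Suc n \<longrightarrow> linear (\<lambda>h. D (Suc n) x (hs[i := h]))"
    using has_jet_multilinear[OF jet, of "Suc n" x] by (simp add: bounded_multilinear_def)
  from this[rule_format, of "h # ks" 0] have lin: "linear (\<lambda>k. D (Suc n) x (k # ks))"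
    using hs by simp
  have bound: "norm (D (Suc n) x hs) \<le> e * (norm h * ?P)" if "e > 0" for e
  proof -
    obtain d where d: "d > 0" "\<And>h hs. norm h < d \<Longrightarrow> length hs = n \<Longrightarrow>
        norm (D n (x + h) hs - D n x hs - D (Suc n) x (h # hs)) \<le> e * norm h * prod_list (map norm hs)"
      using has_jet_remainder[OF jet \<open>e > 0\<close>] by blast
    obtain r where r: "r > 0" "ball x r \<subseteq> U"
      using \<open>open U\<close> Suc.prems open_contains_ball by blast
    \<comment> \<open>The factor shrinks \<open>h\<close> below both radii; the added 1 covers
      \<open>h = 0\<close>.\<close>
    define t where "t = min d r / (norm h + 1)"
    have "t > 0" using d r by (simp add: t_def add_nonneg_pos)
    have "norm h / (norm h + 1) < 1" by (simp add: divide_less_eq add_nonneg_pos)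
    then have "norm (t *\<^sub>R h) < min d r"
      using mult_strict_left_mono[of "norm h / (norm h + 1)" 1 "min d r"] d r \<open>t > 0\<close>
      by (simp add: t_def)
    then have small: "norm (t *\<^sub>R h) < d" "x + t *\<^sub>R h \<in> U"
      using r by (auto simp: dist_norm subset_iff)
    have "norm (D (Suc n) x (t *\<^sub>R h # ks)) \<le> e * norm (t *\<^sub>R h) * ?P"
      using d(2)[OF small(1) hs(2)] Suc.IH[OF small(2) hs(2)] Suc.IH[OF Suc.prems(1) hs(2)] by simp
    then have "t * norm (D (Suc n) x hs) \<le> t * (e * (norm h * ?P))"
      using \<open>t > 0\<close> linear_scale[OF lin, of t h] by (simp add: hs(1) mult_ac)
    then show ?thesis using \<open>t > 0\<close> by simp
  qed
  have "norm (D (Suc n) x hs) \<le> 0"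
  proof (rule field_le_epsilon)
    fix e :: real assume "e > 0"
    have nn: "0 \<le> norm h * ?P" using prod_list_norm_nonneg by (intro mult_nonneg_nonneg) auto
    then have "norm (D (Suc n) x hs) \<le> e / (norm h * ?P + 1) * (norm h * ?P)"
      using \<open>e > 0\<close> by (intro bound divide_pos_pos) auto
    also have "\<dots> \<le> e" using \<open>e > 0\<close> nn by (simp add: field_simps)
    finally show "norm (D (Suc n) x hs) \<le> 0 + e" by simp
  qed
  then show ?case by simp
qed

text \<open>Near each point all nonzero terms have indices in one finite set, so the sum of their
  jets satisfies the estimates there. A single jet for the whole space comes from an index set that
  depends only on the point.\<close>

lemma smooth_map_locally_finite_sum:
  fixes F :: "'k \<Rightarrow> 'a::real_normed_vector \<Rightarrow> 'b::real_normed_vector"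
  assumes smooth: "\<And>k. smooth_map (F k)"
    and fin: "\<And>x. \<exists>r>0. finite {k. \<exists>y\<in>ball x r. F k y \<noteq> 0}"
  shows "smooth_map (\<lambda>x. \<Sum>k | F k x \<noteq> 0. F k x)"
proof -
  obtain D where jet: "\<And>k. has_jet (F k) (D k)"
    using smooth unfolding smooth_map_iff_has_jet by metis
  \<comment> \<open>The indices of the terms whose closed support contains \<open>x\<close>; unlike the indices of the terms
    that are nonzero at \<open>x\<close>, they also account for all derivatives at \<open>x\<close>.\<close>
  define S where "S x = {k. \<forall>r>0. \<exists>y\<in>ball x r. F k y \<noteq> 0}" for x
  define D' where "D' n x hs = (\<Sum>k\<in>S x. D k n x hs)" for n x hs
  obtain r where r: "\<And>x. r x > 0" "\<And>x. finite {k. \<exists>y\<in>ball x (r x). F k y \<noteq> 0}"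
    using choice[of "\<lambda>x r. r > 0 \<and> finite {k. \<exists>y\<in>ball x r. F k y \<noteq> 0}"] fin by blast
  define J where "J x = {k. \<exists>y\<in>ball x (r x). F k y \<noteq> 0}" for x
  have finJ: "finite (J x)" for x using r by (simp add: J_def)
  have SJ: "S y \<subseteq> J x" if y: "y \<in> ball x (r x)" for x y
  proof
    fix k assume "k \<in> S y"
    obtain q where "q > 0" "ball y q \<subseteq> ball x (r x)"
      using y open_ball open_contains_ball by blast
    then show "k \<in> J x" using \<open>k \<in> S y\<close> unfolding S_def J_def by blast
  qed
  have D'_eq: "D' n y hs = (\<Sum>k\<in>J x. D k n y hs)" if "y \<in> ball x (r x)" "length hs = n" for x y n hs
    unfolding D'_def
  \<comment> \<open>A term with index in \<open>J x\<close> but outside \<open>S y\<close> is zero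
    near \<open>y\<close>, hence so are its derivatives at \<open>y\<close>. Passing to
    \<open>J x\<close> puts \<open>x\<close> and \<open>x + h\<close> under the same finite
    sum.\<close>
  proof (rule sum.mono_neutral_left[OF finJ SJ[OF that(1)]], rule ballI)
    fix k assume "k \<in> J x - S y"
    then obtain q where "q > 0" "\<And>z. z \<in> ball y q \<Longrightarrow> F k z = 0"
      unfolding S_def by blast
    then show "D k n y hs = 0"
      using that by (intro has_jet_vanishes[OF jet, of "ball y q"]) auto
  qed
  have "has_jet (\<lambda>x. \<Sum>k | F k x \<noteq> 0. F k x) D'"
    unfolding has_jet_def
  proof (intro conjI allI impI)
    fix x
    have "D' 0 x [] = (\<Sum>k\<in>J x. F k x)"
      using D'_eq[of x x "[]" 0] r(1)[of x] by (simp add: has_jet_0[OF jet])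
    also have "\<dots> = (\<Sum>k | F k x \<noteq> 0. F k x)"
      by (rule sum.mono_neutral_right[OF finJ]) (auto simp: J_def r)
    finally show "D' 0 x [] = (\<Sum>k | F k x \<noteq> 0. F k x)" .
  next
    fix n x
    show "bounded_multilinear n (D' n x)"
      unfolding D'_def by (intro bounded_multilinear_sum has_jet_multilinear[OF jet])
  next
    fix n x and e :: real assume "e > 0"
    obtain d where d: "d > 0" "\<And>h hs. norm h < d \<Longrightarrow> length hs = n \<Longrightarrow>
        norm ((\<Sum>k\<in>J x. D k n (x + h) hs) - (\<Sum>k\<in>J x. D k n x hs) - (\<Sum>k\<in>J x. D k (Suc n) x (h # hs)))
          \<le> e * norm h * prod_list (map norm hs)"
      using has_jet_sum_remainder[where F = F and D = D and J = "J x", OF jet finJ \<open>e > 0\<close>] by blast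
    show "\<exists>d>0. \<forall>h. norm h < d \<longrightarrow> (\<forall>hs. length hs = n \<longrightarrow>
        norm (D' n (x + h) hs - D' n x hs - D' (Suc n) x (h # hs)) \<le> e * norm h * prod_list (map norm hs))"
    proof (intro exI[of _ "min d (r x)"] conjI allI impI)
      fix h :: 'a and hs :: "'a list"
      assume h: "norm h < min d (r x)" and hs: "length hs = n"
      then have "x + h \<in> ball x (r x)" "x \<in> ball x (r x)"
        using r by (auto simp: dist_norm)
      then show "norm (D' n (x + h) hs - D' n x hs - D' (Suc n) x (h # hs))
          \<le> e * norm h * prod_list (map norm hs)"
        using d(2)[of h hs] h hs by (simp add: D'_eq[of _ x])
    qed (use d r in simp)
  qed
  then show ?thesis unfolding smooth_map_iff_has_jet by blast
qed

lemma smooth_map_add: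
  fixes f g :: "'a::real_normed_vector \<Rightarrow> 'b::real_normed_vector"
  assumes "smooth_map f" "smooth_map g"
  shows "smooth_map (\<lambda>x. f x + g x)"
proof -
  obtain D E where "has_jet f D" "has_jet g E"
    using assms unfolding smooth_map_iff_has_jet by blast
  \<comment> \<open>Two summands form a family over \<open>bool\<close>, to which the finite sum
    estimate applies.\<close>
  then have jet: "has_jet (if b then f else g) (if b then D else E)" for b by simp
  have rem: "\<exists>d>0. \<forall>h hs. norm h < d \<longrightarrow> length hs = n \<longrightarrow>
    norm ((\<Sum>b\<in>UNIV. (if b then D else E) n (x + h) hs) - (\<Sum>b\<in>UNIV. (if b then D else E) n x hs)
        - (\<Sum>b\<in>UNIV. (if b then D else E) (Suc n) x (h # hs)))
      \<le> e * norm h * prod_list (map norm hs)" if "e > 0" for n x and e :: real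
    by (rule has_jet_sum_remainder[OF jet _ that]) simp
  have "has_jet (\<lambda>x. f x + g x) (\<lambda>n x hs. \<Sum>b\<in>UNIV. (if b then D else E) n x hs)"
    unfolding has_jet_def
  proof (intro conjI allI impI)
    show "(\<Sum>b\<in>UNIV. (if b then D else E) 0 x []) = f x + g x" for x
      using \<open>has_jet f D\<close> \<open>has_jet g E\<close> by (simp add: UNIV_bool has_jet_0)
    show "bounded_multilinear n (\<lambda>hs. \<Sum>b\<in>UNIV. (if b then D else E) n x hs)" for n x
      by (intro bounded_multilinear_sum has_jet_multilinear[OF jet])
  qed (use rem in meson)
  then show ?thesis unfolding smooth_map_iff_has_jet by blast
qed

section \<open>Products of smooth functions of affine functionals\<close>

text \<open>
  Index \<open>s i j\<close> names the \<open>i\<close>-th partial derivative of \<open>F j\<close>, taken along the functional \<open>\<phi> i\<close>.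
\<close>

primrec family_jet ::
    "'i set \<Rightarrow> ('i \<Rightarrow> 'a \<Rightarrow> real) \<Rightarrow> ('i \<Rightarrow> 'j \<Rightarrow> 'j) \<Rightarrow> ('j \<Rightarrow> 'a \<Rightarrow> 'b) \<Rightarrow> 'a list \<Rightarrow> 'j \<Rightarrow> 'a \<Rightarrow> 'b::real_normed_vector"
where
  "family_jet I \<phi> s F [] j x = F j x"
| "family_jet I \<phi> s F (h # hs) j x = (\<Sum>i\<in>I. \<phi> i h *\<^sub>R family_jet I \<phi> s F hs (s i j) x)"

text \<open>The family is closed under partial derivatives, so a derivative of any order is a finite
  combination of members with products of functionals as coefficients. Differentiability of the
  members then gives every order, by induction on the number of directions.\<close>

lemma smooth_map_family:
  fixes F :: "'j \<Rightarrow> 'a::real_normed_vector \<Rightarrow> 'b::real_normed_vector"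
  assumes "finite I" and \<phi>: "\<And>i. i \<in> I \<Longrightarrow> bounded_linear (\<phi> i)"
    and comm: "\<And>i k j. s i (s k j) = s k (s i j)"
    and deriv: "\<And>j x. (F j has_derivative (\<lambda>h. \<Sum>i\<in>I. \<phi> i h *\<^sub>R F (s i j) x)) (at x)"
  shows "smooth_map (F j)"
proof -
  let ?E = "family_jet I \<phi> s F"
  obtain B where B: "\<And>i h. i \<in> I \<Longrightarrow> norm (\<phi> i h) \<le> norm h * B i"
      and B0: "\<And>i. i \<in> I \<Longrightarrow> B i \<ge> 0"
    using bounded_linear.nonneg_bounded[OF \<phi>] by metis
  have lin: "linear (\<lambda>h. ?E (hs[i := h]) j x)" if "i < length hs" for hs i j x
    using that
  proof (induction hs arbitrary: i j)
    case (Cons k hs)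
    show ?case
    proof (cases i)
      case 0
      have "linear (\<lambda>h. \<Sum>i\<in>I. \<phi> i h *\<^sub>R ?E hs (s i j) x)"
        by (rule linear_compose_sum)
           (auto intro: bounded_linear.linear bounded_linear_scaleR_const \<phi>)
      then show ?thesis using 0 by simp
    next
      case (Suc i')
      then show ?thesis
        using Cons by (auto intro!: linear_compose_sum linear_compose_scale_right)
    qed
  qed simp
  have bd: "\<exists>C. \<forall>hs. length hs = n \<longrightarrow> norm (?E hs j x) \<le> C * prod_list (map norm hs)" for n j x
  proof (induction n arbitrary: j)
    case 0
    show ?case by (auto intro!: exI[of _ "norm (F j x)"])
  next
    case (Suc n)
    obtain C where C: "\<And>j hs. length hs = n \<Longrightarrow> norm (?E hs j x) \<le> C j * prod_list (map norm hs)"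
      using Suc by metis
    have "norm (?E hs j x) \<le> (\<Sum>i\<in>I. B i * C (s i j)) * prod_list (map norm hs)"
      if len: "length hs = Suc n" for hs
    proof -
      obtain h ks where hs: "hs = h # ks" "length ks = n" using len by (cases hs) auto
      have "norm (\<phi> i h *\<^sub>R ?E ks (s i j) x) \<le> B i * C (s i j) * prod_list (map norm hs)" if "i \<in> I" for i
        using mult_mono[OF B[OF that, of h] C[OF hs(2), of "s i j"]] B0[OF that]
        by (simp add: hs mult_ac)
      then show ?thesis unfolding sum_distrib_right by (auto simp: hs intro!: sum_norm_le)
    qed
    then show ?case by blast
  qed
  have rem: "\<exists>d>0. \<forall>h. norm h < d \<longrightarrow> (\<forall>hs. length hs = n \<longrightarrow>
      norm (?E hs j (x + h) - ?E hs j x - ?E (h # hs) j x) \<le> e * norm h * prod_list (map norm hs))"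
    if "e > 0" for n j x e
    using that
  proof (induction n arbitrary: j e)
    case 0
    obtain d where "d > 0" "\<And>y. norm (y - x) < d \<Longrightarrow>
        norm (F j y - F j x - (\<Sum>i\<in>I. \<phi> i (y - x) *\<^sub>R F (s i j) x)) \<le> e * norm (y - x)"
      using deriv[of j x] 0 unfolding has_derivative_at_alt by meson
    from this(1) this(2)[of "x + _"] show ?case by (intro exI[of _ d]) auto
  next
    case (Suc n)
    \<comment> \<open>Summing over \<open>I\<close> multiplies the error by at most the sum of the
      \<open>B i\<close>; the added 1 avoids a zero denominator.\<close>
    define e' where "e' = e / ((\<Sum>i\<in>I. B i) + 1)"
    have SB: "(\<Sum>i\<in>I. B i) \<ge> 0" using B0 by (rule sum_nonneg)
    then have "e' > 0" using Suc.prems by (simp add: e'_def)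
    then obtain d where d: "\<And>j. d j > 0" "\<And>j h hs. norm h < d j \<Longrightarrow> length hs = n \<Longrightarrow>
        norm (?E hs j (x + h) - ?E hs j x - ?E (h # hs) j x) \<le> e' * norm h * prod_list (map norm hs)"
      using Suc.IH by metis
    define m where "m = Min (insert 1 ((\<lambda>i. d (s i j)) ` I))"
    have m: "m > 0" "\<And>i. i \<in> I \<Longrightarrow> m \<le> d (s i j)"
      using \<open>finite I\<close> d(1) by (auto simp: m_def)
    show ?case
    proof (intro exI[of _ m] conjI allI impI)
      fix h :: 'a and hs :: "'a list"
      assume h: "norm h < m" and len: "length hs = Suc n"
      obtain k ks where hs: "hs = k # ks" "length ks = n" using len by (cases hs) auto
      let ?P = "prod_list (map norm ks)"
      let ?R = "\<lambda>i. ?E ks (s i j) (x + h) - ?E ks (s i j) x - ?E (h # ks) (s i j) x"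
      \<comment> \<open>The head of the list is the outermost direction, but the recursion differentiates along it
        first: this is where the partial derivatives have to commute.\<close>
      have "?E (h # hs) j x = (\<Sum>i\<in>I. \<phi> i k *\<^sub>R ?E (h # ks) (s i j) x)"
        by (simp add: hs scaleR_sum_right comm[of _ _ j] mult.commute, subst sum.swap, simp add: comm[of _ _ j] mult.commute)
      then have "?E hs j (x + h) - ?E hs j x - ?E (h # hs) j x = (\<Sum>i\<in>I. \<phi> i k *\<^sub>R ?R i)"
        by (simp add: hs(1) scaleR_diff_right sum_subtractf del: family_jet.simps(2)[of _ _ _ _ h])
      also have "norm \<dots> \<le> (\<Sum>i\<in>I. B i * (e' * norm h * (norm k * ?P)))"
      proof (rule sum_norm_le)
        fix i assume "i \<in> I"
        then have "norm (?R i) \<le> e' * norm h * ?P"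
          using d(2)[of h "s i j" ks] m(2) h hs by force
        then have "norm (\<phi> i k) * norm (?R i) \<le> (norm k * B i) * (e' * norm h * ?P)"
          using B[OF \<open>i \<in> I\<close>, of k] B0[OF \<open>i \<in> I\<close>] by (intro mult_mono) auto
        then show "norm (\<phi> i k *\<^sub>R ?R i) \<le> B i * (e' * norm h * (norm k * ?P))"
          by (simp add: mult_ac)
      qed
      also have "\<dots> = ((\<Sum>i\<in>I. B i) * e') * (norm h * (norm k * ?P))"
        by (simp add: sum_distrib_right[symmetric] mult.assoc)
      also have "\<dots> \<le> e * (norm h * (norm k * ?P))"
      proof (rule mult_right_mono)
        show "(\<Sum>i\<in>I. B i) * e' \<le> e" using SB Suc.prems by (simp add: e'_def field_simps)
      qed (intro mult_nonneg_nonneg norm_ge_zero prod_list_norm_nonneg)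
      finally show "norm (?E hs j (x + h) - ?E hs j x - ?E (h # hs) j x) \<le> e * norm h * prod_list (map norm hs)"
        by (simp add: hs mult_ac)
    qed (use m in simp)
  qed
  have "has_jet (F j) (\<lambda>n x hs. ?E hs j x)"
    unfolding has_jet_def bounded_multilinear_def using lin bd rem by auto
  then show ?thesis unfolding smooth_map_iff_has_jet by blast
qed

definition smooth_real :: "(real \<Rightarrow> real) \<Rightarrow> bool" where
  "smooth_real u \<longleftrightarrow> (\<exists>U :: nat \<Rightarrow> real \<Rightarrow> real. U 0 = u \<and>
     (\<forall>k x. (U k has_real_derivative U (Suc k) x) (at x)))"

text \<open>The product rule differentiates one factor at a time, so the partial derivatives are
  indexed by multi-indices counting the derivatives of each factor; raising two entries commutes, as
  \<open>smooth_map_family\<close> requires.\<close>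

lemma smooth_map_prod_affine:
  fixes \<phi> :: "'i \<Rightarrow> 'a::real_normed_vector \<Rightarrow> real"
  assumes "finite I" and u: "\<And>i. i \<in> I \<Longrightarrow> smooth_real (u i)"
    and \<phi>: "\<And>i. i \<in> I \<Longrightarrow> bounded_linear (\<phi> i)"
  shows "smooth_map (\<lambda>x. (\<Prod>i\<in>I. u i (\<phi> i x + c i)) *\<^sub>R v)"
proof -
  obtain U where U0: "\<And>i. i \<in> I \<Longrightarrow> U i 0 = u i"
      and U: "\<And>i k x. i \<in> I \<Longrightarrow> (U i k has_real_derivative U i (Suc k) x) (at x)"
    using u unfolding smooth_real_def by metis
  define F where "F \<alpha> x = (\<Prod>i\<in>I. U i (\<alpha> i) (\<phi> i x + c i)) *\<^sub>R v" for \<alpha> :: "'i \<Rightarrow> nat" and x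
  have "smooth_map (F (\<lambda>_. 0))"
  proof (rule smooth_map_family[where s = "\<lambda>i \<alpha>. \<alpha>(i := Suc (\<alpha> i))", OF \<open>finite I\<close> \<phi>])
    show "(F \<alpha> has_derivative (\<lambda>h. \<Sum>i\<in>I. \<phi> i h *\<^sub>R F (\<alpha>(i := Suc (\<alpha> i))) x)) (at x)" for \<alpha> x
    proof -
      have "((\<lambda>x. U i (\<alpha> i) (\<phi> i x + c i)) has_derivative
          (\<lambda>h. \<phi> i h * U i (Suc (\<alpha> i)) (\<phi> i x + c i))) (at x)" if "i \<in> I" for i
      proof -
        have "((\<lambda>x. \<phi> i x + c i) has_derivative \<phi> i) (at x)"
          using bounded_linear_imp_has_derivative[OF \<phi>[OF that]]
          by (auto intro!: derivative_eq_intros)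
        from has_derivative_compose[OF this U[OF that, unfolded has_field_derivative_def]]
        show ?thesis by (simp add: mult.commute)
      qed
      then have "((\<lambda>x. \<Prod>i\<in>I. U i (\<alpha> i) (\<phi> i x + c i)) has_derivative
          (\<lambda>h. \<Sum>i\<in>I. (\<phi> i h * U i (Suc (\<alpha> i)) (\<phi> i x + c i)) *
             (\<Prod>j\<in>I - {i}. U j (\<alpha> j) (\<phi> j x + c j)))) (at x)"
        by (rule has_derivative_prod)
      also have "(\<lambda>h. \<Sum>i\<in>I. (\<phi> i h * U i (Suc (\<alpha> i)) (\<phi> i x + c i)) *
             (\<Prod>j\<in>I - {i}. U j (\<alpha> j) (\<phi> j x + c j))) =
          (\<lambda>h. \<Sum>i\<in>I. \<phi> i h * (\<Prod>j\<in>I. U j ((\<alpha>(i := Suc (\<alpha> i))) j) (\<phi> j x + c j)))"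
        using \<open>finite I\<close> by (intro ext sum.cong) (auto simp: prod.remove mult_ac)
      finally show ?thesis
        unfolding F_def by (auto dest: has_derivative_scaleR_left simp: scaleR_sum_left)
    qed
  qed (auto simp: fun_eq_iff)
  also have "F (\<lambda>_. 0) = (\<lambda>x. (\<Prod>i\<in>I. u i (\<phi> i x + c i)) *\<^sub>R v)"
    using U0 by (simp add: F_def fun_eq_iff)
  finally show ?thesis .
qed


section \<open>Flat functions\<close>

text \<open>\<open>flat 1\<close> is the classical exp(-1/x), extended by 0. The polynomial in 1/x
  makes the family closed under differentiation.\<close>

definition flat :: "real poly \<Rightarrow> real \<Rightarrow> real" where
  "flat q x = (if x > 0 then poly q (inverse x) * exp (- inverse x) else 0)"

lemma poly_div_exp_tendsto_0: "((\<lambda>y::real. poly q y * exp (- y)) \<longlongrightarrow> 0) at_top"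
proof -
  have "((\<lambda>y::real. \<Sum>i\<le>degree q. coeff q i * (y ^ i / exp y)) \<longlongrightarrow> (\<Sum>i\<le>degree q. coeff q i * 0)) at_top"
    by (intro tendsto_intros tendsto_power_div_exp_0)
  then show ?thesis
    by (simp add: poly_altdef sum_distrib_right exp_minus divide_inverse mult.assoc)
qed

lemma flat_tendsto_0: "(flat q \<longlongrightarrow> 0) (at 0)"
proof (rule filterlim_split_at)
  show "(flat q \<longlongrightarrow> 0) (at_left 0)"
    by (rule tendsto_eventually, rule eventually_at_leftI[of "-1"]) (auto simp: flat_def)
  have "((\<lambda>x. poly q (inverse x) * exp (- inverse x)) \<longlongrightarrow> 0) (at_right 0)"
    by (rule filterlim_compose[OF poly_div_exp_tendsto_0 filterlim_inverse_at_top_right])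
  then show "(flat q \<longlongrightarrow> 0) (at_right 0)"
    by (rule Lim_transform_eventually) (rule eventually_at_rightI[of 0 1], auto simp: flat_def)
qed

text \<open>With y = 1/x one has d/dx = -y^2 d/dy, which turns q(y) exp(-y) into y^2 (q(y) - q'(y))
  exp(-y); the factor \<open>[:0, 0, 1:]\<close> is y^2.\<close>

lemma DERIV_flat: "(flat q has_real_derivative flat ((q - pderiv q) * [:0, 0, 1:]) x) (at x)"
proof (cases x "0 :: real" rule: linorder_cases)
  case less
  have "(flat q has_real_derivative 0) (at x)"
    by (rule has_field_derivative_transform_within_open[of "\<lambda>_. 0" _ _ "{..<0}"])
       (use less in \<open>auto simp: flat_def\<close>)
  then show ?thesis using less by (simp add: flat_def[of _ x])
next
  case equal
  have "flat q h / h = flat (pCons 0 q) h" for h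
    by (simp add: flat_def divide_inverse)
  then have "((\<lambda>h. (flat q (0 + h) - flat q 0) / h) \<longlongrightarrow> 0) (at 0)"
    using flat_tendsto_0[of "pCons 0 q"] by (simp add: flat_def[of _ 0])
  then show ?thesis using equal by (simp add: DERIV_def flat_def[of _ 0])
next
  case greater
  have "((\<lambda>x. poly q (inverse x) * exp (- inverse x)) has_real_derivative
      flat ((q - pderiv q) * [:0, 0, 1:]) x) (at x)"
    using greater
    by (auto intro!: derivative_eq_intros poly_DERIV[THEN DERIV_chain2] simp: flat_def algebra_simps power2_eq_square)
  then show ?thesis
    by (rule has_field_derivative_transform_within_open[of _ _ _ "{0<..}"]) (use greater in \<open>auto simp: flat_def\<close>)
qed

lemma smooth_real_flat: "smooth_real (flat q)"
  unfolding smooth_real_def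
proof (intro exI conjI allI)
  let ?d = "\<lambda>q. (q - pderiv q) * [:0, 0, 1 :: real:]"
  show "flat ((?d ^^ 0) q) = flat q" by simp
  show "(flat ((?d ^^ k) q) has_real_derivative flat ((?d ^^ Suc k) q) x) (at x)" for k x
    unfolding funpow.simps o_apply by (rule DERIV_flat)
qed

lemma smooth_real_ident: "smooth_real (\<lambda>x. x)"
  unfolding smooth_real_def
  by (rule exI[of _ "\<lambda>k x. if k = 0 then x else if k = 1 then 1 else 0"]) auto

lemma flat_1_pos_iff: "flat 1 x > 0 \<longleftrightarrow> x > 0"
  by (simp add: flat_def)

lemma flat_1_eq_0_iff: "flat 1 x = 0 \<longleftrightarrow> x \<le> 0"
  by (simp add: flat_def)

lemma flat_1_nonneg: "flat 1 x \<ge> 0"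
  by (simp add: flat_def)

lemma isCont_flat: "isCont (flat q) x"
  using DERIV_flat by (rule DERIV_isCont)

text \<open>The derivative is kept as a product of two flat functions, so that the vector field can
  be assembled from factors of the form in \<open>smooth_map_prod_affine\<close>.\<close>

locale smooth_step =
  fixes G :: "real \<Rightarrow> real" and K :: real
  assumes deriv: "\<And>z. (G has_real_derivative K * (flat 1 z * flat 1 (1 - z))) (at z)"
    and eq_0: "\<And>z. z \<le> 0 \<Longrightarrow> G z = 0"
    and eq_1: "\<And>z. z \<ge> 1 \<Longrightarrow> G z = 1"
    and range: "\<And>z. 0 \<le> G z \<and> G z \<le> 1"

lemma smooth_step_exists: "\<exists>G K. smooth_step G K"
proof -
  let ?b = "\<lambda>z. flat 1 z * flat 1 (1 - z)"
  have "isCont ?b z" for z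
    by (intro continuous_intros isCont_flat isCont_o2[where f = "\<lambda>z. 1 - z" and g = "flat 1"])
  then obtain F where F': "\<And>z. (F has_vector_derivative ?b z) (at z)"
    using einterval_antiderivative[of "-\<infinity>" "\<infinity>" ?b] by auto
  have F: "(F has_real_derivative ?b z) (at z)" for z
    using F' by (simp add: has_real_derivative_iff_has_vector_derivative)
  have mono: "F x \<le> F y" if "x \<le> y" for x y
    using that F flat_1_nonneg by (intro DERIV_nonneg_imp_nondecreasing[of x y F]) (auto intro!: exI mult_nonneg_nonneg)
  have const: "F x = F y" if "x \<le> y" "\<And>z. x \<le> z \<Longrightarrow> z \<le> y \<Longrightarrow> ?b z = 0" for x y
  proof (cases "x = y")
    case False
    then obtain z where "x < z" "z < y" "F y - F x = (y - x) * ?b z"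
      using MVT2[of x y F ?b] F \<open>x \<le> y\<close> by auto
    then show ?thesis using that by simp
  qed simp
  obtain z where "0 < z" "z < 1" "F 1 - F 0 = (1 - 0) * ?b z"
    using MVT2[of 0 1 F ?b] F by auto
  then have pos: "F 1 - F 0 > 0" using flat_1_pos_iff by simp
  have F0: "F z = F 0" if "z \<le> 0" for z
    using const[OF that] by (simp add: flat_1_eq_0_iff)
  have F1: "F z = F 1" if "z \<ge> 1" for z
    using const[OF that] by (simp add: flat_1_eq_0_iff)
  define G where "G z = (F z - F 0) / (F 1 - F 0)" for z
  have "smooth_step G (1 / (F 1 - F 0))"
  proof
    fix z
    show "(G has_real_derivative 1 / (F 1 - F 0) * ?b z) (at z)"
      unfolding G_def using pos by (auto intro!: derivative_eq_intros F)
    show "z \<le> 0 \<Longrightarrow> G z = 0" "z \<ge> 1 \<Longrightarrow> G z = 1"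
      using F0[of z] F1[of z] pos by (simp_all add: G_def)
    have "F 0 \<le> F z" "F z \<le> F 1"
      using mono F0[of z] F1[of z] by (metis linear)+
    then show "0 \<le> G z \<and> G z \<le> 1"
      using pos by (simp add: G_def divide_le_eq)
  qed
  then show ?thesis by blast
qed

section \<open>Coordinates\<close>

lift_definition unit_vec :: "'i \<Rightarrow> 'i ell2" is "\<lambda>i j. if j = i then 1 else 0"
proof -
  fix i :: 'i
  have "(\<lambda>j. (if j = i then 1 else 0 :: real)\<^sup>2) summable_on {i}" by (rule summable_on_finite) simp
  then show "square_summable (\<lambda>j. if j = i then 1 else 0)"
    unfolding square_summable_def by (rule summable_on_cong_neutral[THEN iffD1, rotated 3]) auto
qed

lemma coord_unit_vec [simp]: "coord (unit_vec i) j = (if j = i then 1 else 0)"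
  by (rule unit_vec.rep_eq[THEN fun_cong])

lemma norm_unit_vec [simp]: "norm (unit_vec i) = 1"
proof -
  have "inner (unit_vec i) (unit_vec i) = (\<Sum>\<^sub>\<infinity>j\<in>{i}. 1)"
    unfolding inner_ell2.rep_eq by (rule infsum_cong_neutral) auto
  then show ?thesis by (simp add: norm_eq_sqrt_inner)
qed

lemma coord_add [simp]: "coord (x + y) i = coord x i + coord y i"
  by (simp add: plus_ell2.rep_eq)

lemma coord_diff [simp]: "coord (x - y) i = coord x i - coord y i"
  by (simp add: minus_ell2.rep_eq)

lemma coord_scaleR [simp]: "coord (r *\<^sub>R x) i = r * coord x i"
  by (simp add: scaleR_ell2.rep_eq)

lemma bounded_linear_coord: "bounded_linear (\<lambda>x. coord x i)"
  by (rule bounded_linear_intro[of _ 1]) (simp_all add: abs_coord_le)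

text \<open>Each coordinate above \<open>c\<close> adds more than c^2 to the squared norm. This
  makes the cutoffs in the vector field locally finite.\<close>

lemma finite_large_coords:
  assumes "c > 0"
  shows "finite {i. coord x i > c}"
proof (rule ccontr)
  assume inf: "infinite {i. coord x i > c}"
  obtain n :: nat where n: "(norm x)\<^sup>2 / c\<^sup>2 < n" using reals_Archimedean2 by blast
  obtain A where A: "finite A" "card A = n" "A \<subseteq> {i. coord x i > c}"
    using infinite_arbitrarily_large[OF inf] by blast
  have "n * c\<^sup>2 = (\<Sum>i\<in>A. c\<^sup>2)" using A by simp
  also have "\<dots> \<le> (\<Sum>i\<in>A. (coord x i)\<^sup>2)"
    using A assms by (intro sum_mono power_mono) auto
  also have "\<dots> \<le> (norm x)\<^sup>2" using A(1) by (rule sum_coord_square_le)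
  finally show False using n assms by (simp add: divide_less_eq)
qed

section \<open>The vector field and its solution\<close>

text \<open>The affine function taking the clock interval from 1 - 2^(-k) to 1 - 2^(-k-1) onto
  [0, 1]: negative before slot \<open>k\<close>, above 1 after it.\<close>

definition slot :: "nat \<Rightarrow> real \<Rightarrow> real" where
  "slot k s = 2 ^ Suc k * (s - 1) + 2"

lemma slot_Suc: "slot (Suc k) s = 2 * slot k s - 2"
  by (simp add: slot_def)

lemma slot_antimono: "s \<le> 1 \<Longrightarrow> k \<le> l \<Longrightarrow> slot l s \<le> slot k s"
  unfolding slot_def by (intro add_right_mono mult_right_mono_neg) (auto intro: power_increasing)

lemma slot_eventually_neg:
  assumes "s < 1"
  obtains k where "slot k s < 0"
proof -
  obtain k where "2 / (1 - s) < 2 ^ k" using real_arch_pow[of 2] by auto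
  then have "2 < 2 ^ k * (1 - s)" using assms by (simp add: divide_less_eq)
  also have "\<dots> \<le> 2 ^ Suc k * (1 - s)" using assms by simp
  finally show ?thesis by (intro that[of k]) (simp add: slot_def algebra_simps)
qed

text \<open>The current slot is the first one that reads at most 1: its predecessor reads more than
  1, so \<open>slot_Suc\<close> makes it nonnegative.\<close>

lemma slot_cover:
  assumes "0 < s" "s < 1"
  obtains k where "0 \<le> slot k s" "slot k s \<le> 1"
proof -
  define k where "k = (LEAST k. slot k s \<le> 1)"
  obtain l where "slot l s < 0" using slot_eventually_neg[OF assms(2)] by blast
  then have "slot l s \<le> 1" by simp
  then have k: "slot k s \<le> 1" unfolding k_def by (rule LeastI)
  have "0 \<le> slot k s"
  proof (cases k)
    case 0
    then show ?thesis using assms by (simp add: slot_def)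
  next
    case (Suc j)
    then have "\<not> slot j s \<le> 1" using not_less_Least[of j "\<lambda>k. slot k s \<le> 1"] by (simp add: k_def)
    then show ?thesis using Suc slot_Suc by simp
  qed
  then show ?thesis using k that by blast
qed

abbreviation unit_at :: "nat \<Rightarrow> int ell2" where "unit_at k \<equiv> unit_vec (int k)"

lemma unit_at_telescope: "unit_at 1 + unit_at 2 + (\<Sum>k<n. unit_at (k + 3) - unit_at (k + 1)) = unit_at (n + 1) + unit_at (n + 2)"
  by (induction n) (simp_all add: algebra_simps)

section \<open>The vector field and its smoothness\<close>

context smooth_step
begin

text \<open>The leading \<open>coord x 0\<close> is the chain rule factor from s' = s,
  \<open>2 ^ Suc k\<close> is the slope of \<open>slot k\<close>, and \<open>K\<close> with the next
  two flat factors gives the derivative of \<open>G\<close>. The cutoff equals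
  \<open>flat 1 (1 / 2)\<close> when its coordinate is 1, whence the division.\<close>

definition stage :: "nat \<Rightarrow> int ell2 \<Rightarrow> int ell2" where
  "stage k x =
     (coord x 0 * flat 1 (slot k (coord x 0)) * flat 1 (1 - slot k (coord x 0)) *
        flat 1 (coord x (int (k + 2)) - 1 / 2)) *\<^sub>R
     ((K * 2 ^ Suc k / flat 1 (1 / 2)) *\<^sub>R (unit_at (k + 3) - unit_at (k + 1)))"

definition field :: "int ell2 \<Rightarrow> int ell2" where
  "field x = coord x 0 *\<^sub>R unit_at 0 + (\<Sum>k | stage k x \<noteq> 0. stage k x)"

lemma smooth_map_stage: "smooth_map (stage k)"
proof -
  \<comment> \<open>Four factors: the clock, the two halves of the bump, the cutoff. The lists hold
    the slope, the coordinate and the constant of each affine argument.\<close>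
  let ?u = "\<lambda>i::nat. if i = 0 then (\<lambda>x. x) else flat 1"
  let ?\<phi> = "\<lambda>i x. [1, 2 ^ Suc k, - (2 ^ Suc k), 1] ! i * coord x ([0, 0, 0, int (k + 2)] ! i)"
  let ?c = "\<lambda>i. [0, 2 - 2 ^ Suc k, 2 ^ Suc k - 1, - 1 / 2] ! i"
  have "smooth_map (\<lambda>x. (\<Prod>i\<in>{..<4}. ?u i (?\<phi> i x + ?c i)) *\<^sub>R
      ((K * 2 ^ Suc k / flat 1 (1 / 2)) *\<^sub>R (unit_at (k + 3) - unit_at (k + 1))))"
    by (rule smooth_map_prod_affine)
       (auto simp: smooth_real_ident smooth_real_flat intro: bounded_linear_const_mult bounded_linear_coord)
  also have "(\<lambda>x. (\<Prod>i\<in>{..<4}. ?u i (?\<phi> i x + ?c i)) *\<^sub>R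
      ((K * 2 ^ Suc k / flat 1 (1 / 2)) *\<^sub>R (unit_at (k + 3) - unit_at (k + 1)))) = stage k"
    by (rule ext) (simp add: stage_def slot_def eval_nat_numeral lessThan_Suc algebra_simps)
  finally show ?thesis .
qed

lemma smooth_map_field: "smooth_map field"
proof -
  have "smooth_map (\<lambda>x. (\<Prod>i\<in>{()}. (\<lambda>x. x) (coord x 0 + 0)) *\<^sub>R unit_at 0)"
    by (rule smooth_map_prod_affine) (auto simp: smooth_real_ident bounded_linear_coord)
  then have "smooth_map (\<lambda>x. coord x 0 *\<^sub>R unit_at 0)" by simp
  moreover have "smooth_map (\<lambda>x. \<Sum>k | stage k x \<noteq> 0. stage k x)"
  proof (rule smooth_map_locally_finite_sum[OF smooth_map_stage])
    fix x :: "int ell2"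
    \<comment> \<open>If some \<open>y\<close> within 1/4 of \<open>x\<close> passes the cutoff, its
      coordinate exceeds 1/2, so that of \<open>x\<close> exceeds 1/4.\<close>
    have "{k. \<exists>y\<in>ball x (1/4). stage k y \<noteq> 0} \<subseteq> (\<lambda>k. int (k + 2)) -` {i. coord x i > 1/4}"
    proof
      fix k assume "k \<in> {k. \<exists>y\<in>ball x (1/4). stage k y \<noteq> 0}"
      then obtain y where y: "dist x y < 1/4" "stage k y \<noteq> 0" by auto
      then have "coord y (int (k + 2)) > 1/2"
        by (auto simp: stage_def flat_1_eq_0_iff)
      moreover have "\<bar>coord (x - y) (int (k + 2))\<bar> < 1/4"
        using abs_coord_le[of "x - y" "int (k + 2)"] y by (simp add: dist_norm)
      ultimately have "1/4 < coord x (int (k + 2))" unfolding coord_diff by linarith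
      then show "k \<in> (\<lambda>k. int (k + 2)) -` {i. coord x i > 1/4}" by simp
    qed
    moreover have "finite ((\<lambda>k::nat. int (k + 2)) -` {i. coord x i > 1/4})"
      by (intro finite_vimageI finite_large_coords) (auto simp: inj_def)
    ultimately show "\<exists>r>0. finite {k. \<exists>y\<in>ball x r. stage k y \<noteq> 0}"
      by (intro exI[of _ "1/4"]) (auto intro: finite_subset)
  qed
  ultimately show ?thesis unfolding field_def by (rule smooth_map_add)
qed

section \<open>The curve as a function of the clock value\<close>

definition curve :: "real \<Rightarrow> int ell2" where
  "curve s = s *\<^sub>R unit_at 0 + unit_at 1 + unit_at 2 + (\<Sum>k | G (slot k s) \<noteq> 0. G (slot k s) *\<^sub>R (unit_at (k + 3) - unit_at (k + 1)))"

text \<open>Before the clock reaches 1 only finitely many slots have started. At s = 1 every index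
  qualifies, and the sum in \<open>curve\<close> over an infinite set defaults to 0.\<close>

lemma curve_eq_finite_sum:
  assumes "s \<le> 1" "slot n s \<le> 0"
  shows "curve s = s *\<^sub>R unit_at 0 + unit_at 1 + unit_at 2 + (\<Sum>k<n. G (slot k s) *\<^sub>R (unit_at (k + 3) - unit_at (k + 1)))"
proof -
  have "G (slot k s) = 0" if "\<not> k < n" for k
    using slot_antimono[OF assms(1), of n k] that assms(2) by (intro eq_0) simp
  then show ?thesis unfolding curve_def
    by (intro arg_cong2[where f = "(+)"] refl sum.mono_neutral_left) auto
qed

lemma curve_in_slot:
  assumes "s \<le> 1" "0 \<le> slot k s" "slot k s \<le> 1"
  shows "curve s = s *\<^sub>R unit_at 0 + unit_at (k + 1) + unit_at (k + 2) + G (slot k s) *\<^sub>R (unit_at (k + 3) - unit_at (k + 1))"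
proof -
  \<comment> \<open>Slot \<open>Suc j\<close> reads at least 0, so slot \<open>j\<close> reads at
    least 1: all earlier moves are complete, and their sum telescopes.\<close>
  have "G (slot j s) = 1" if "j < k" for j
    using slot_antimono[OF assms(1), of "Suc j" k] that assms(2) by (intro eq_1) (simp add: slot_Suc)
  then have "(\<Sum>j<k. G (slot j s) *\<^sub>R (unit_at (j + 3) - unit_at (j + 1))) = (\<Sum>j<k. unit_at (j + 3) - unit_at (j + 1))"
    by (intro sum.cong) auto
  moreover have "slot (Suc k) s \<le> 0" using assms(3) by (simp add: slot_Suc)
  ultimately show ?thesis
    using curve_eq_finite_sum[OF assms(1), of "Suc k"] unit_at_telescope[of k]
    by (simp add: algebra_simps)
qed

text \<open>The bound adds 1 for the clock, 1 for each of two unit vectors, and 2 for the move in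
  progress.\<close>

lemma norm_curve_le:
  assumes "0 < s" "s < 1"
  shows "norm (curve s) \<le> 5"
proof -
  obtain k where k: "0 \<le> slot k s" "slot k s \<le> 1" using slot_cover[OF assms] by blast
  have "norm (unit_at (k + 3) - unit_at (k + 1)) \<le> 2"
    using norm_triangle_ineq4[of "unit_at (k + 3)" "unit_at (k + 1)"] by simp
  then have "norm (G (slot k s) *\<^sub>R (unit_at (k + 3) - unit_at (k + 1))) \<le> 1 * 2"
    unfolding norm_scaleR using range[of "slot k s"] by (intro mult_mono) auto
  moreover have "norm (s *\<^sub>R unit_at 0) \<le> 1" "norm (unit_at (k + 1)) = 1" "norm (unit_at (k + 2)) = 1"
    using assms by auto
  moreover have c: "curve s = s *\<^sub>R unit_at 0 + unit_at (k + 1) + unit_at (k + 2) + G (slot k s) *\<^sub>R (unit_at (k + 3) - unit_at (k + 1))"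
    using curve_in_slot k assms by simp
  ultimately show ?thesis
    unfolding c using norm_triangle_ineq[of "s *\<^sub>R unit_at 0 + unit_at (k + 1) + unit_at (k + 2)" "G (slot k s) *\<^sub>R (unit_at (k + 3) - unit_at (k + 1))"]
      norm_triangle_ineq[of "s *\<^sub>R unit_at 0 + unit_at (k + 1)" "unit_at (k + 2)"]
      norm_triangle_ineq[of "s *\<^sub>R unit_at 0" "unit_at (k + 1)"]
    by linarith
qed

lemma coord_curve_0:
  assumes "0 < s" "s < 1"
  shows "coord (curve s) 0 = s"
proof -
  obtain k where k: "0 \<le> slot k s" "slot k s \<le> 1" using slot_cover[OF assms] by blast
  then show ?thesis using curve_in_slot[of s k] assms by simp
qed

text \<open>Inside slot \<open>k\<close> the coordinate \<open>k + 2\<close> of the curve is 1, so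
  the cutoff cancels against its normalisation; at other times the bump is zero on both sides. What
  remains is \<open>s\<close> times the derivative of the \<open>k\<close>-th summand of
  \<open>curve\<close>.\<close>

lemma stage_curve:
  assumes "0 < s" "s < 1"
  shows "stage k (curve s) =
    (s * (K * (flat 1 (slot k s) * flat 1 (1 - slot k s)) * 2 ^ Suc k)) *\<^sub>R (unit_at (k + 3) - unit_at (k + 1))"
proof (cases "0 < slot k s \<and> slot k s < 1")
  case True
  then have "coord (curve s) (int (k + 2)) = 1"
    using curve_in_slot[of s k] assms by simp
  then show ?thesis
    using coord_curve_0[OF assms] flat_1_pos_iff[of "1/2"] by (simp add: stage_def)
next
  case False
  then have "flat 1 (slot k s) = 0 \<or> flat 1 (1 - slot k s) = 0"
    by (auto simp: flat_1_eq_0_iff)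
  then show ?thesis using coord_curve_0[OF assms] by (auto simp: stage_def)
qed

text \<open>With the clock s as parameter and s' = s, the equation x' = f(x) becomes dx/ds =
  f(x)/s.\<close>

lemma curve_solves:
  assumes "0 < s" "s < 1"
  shows "(curve has_vector_derivative (1 / s) *\<^sub>R field (curve s)) (at s)"
proof -
  obtain n where n: "slot n s < 0" using slot_eventually_neg[OF assms(2)] by blast
  let ?v = "\<lambda>k. unit_at (k + 3) - unit_at (k + 1)"
  let ?g = "\<lambda>k. K * (flat 1 (slot k s) * flat 1 (1 - slot k s)) * 2 ^ Suc k"
  have "stage k (curve s) = 0" if "\<not> k < n" for k
    using slot_antimono[of s n k] that n assms by (simp add: stage_curve flat_1_eq_0_iff)
  then have "(\<Sum>k | stage k (curve s) \<noteq> 0. stage k (curve s)) = (\<Sum>k<n. stage k (curve s))"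
    by (intro sum.mono_neutral_left) auto
  then have field: "(1 / s) *\<^sub>R field (curve s) = unit_at 0 + (\<Sum>k<n. ?g k *\<^sub>R ?v k)"
    using assms
    by (simp add: field_def coord_curve_0 stage_curve scaleR_add_right scaleR_sum_right)
  have g: "((\<lambda>s. G (slot k s)) has_real_derivative ?g k) (at s)" for k
    by (rule DERIV_chain2[OF deriv]) (auto simp: slot_def intro!: derivative_eq_intros)
  have "((\<lambda>s. G (slot k s) *\<^sub>R ?v k) has_vector_derivative ?g k *\<^sub>R ?v k) (at s)" for k
    using has_vector_derivative_scaleR[OF g has_vector_derivative_const] by simp
  moreover have "((\<lambda>s. s *\<^sub>R unit_at 0) has_vector_derivative unit_at 0) (at s)"
    using has_vector_derivative_scaleR[OF DERIV_ident has_vector_derivative_const] by simp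
  ultimately have "((\<lambda>s. s *\<^sub>R unit_at 0 + unit_at 1 + unit_at 2 + (\<Sum>k<n. G (slot k s) *\<^sub>R ?v k)) has_vector_derivative
      unit_at 0 + 0 + 0 + (\<Sum>k<n. ?g k *\<^sub>R ?v k)) (at s)"
    by (intro has_vector_derivative_add has_vector_derivative_sum has_vector_derivative_const)
  then have "((\<lambda>s. s *\<^sub>R unit_at 0 + unit_at 1 + unit_at 2 + (\<Sum>k<n. G (slot k s) *\<^sub>R ?v k)) has_vector_derivative
      unit_at 0 + (\<Sum>k<n. ?g k *\<^sub>R ?v k)) (at s)"
    by simp
  \<comment> \<open>On this open set no slot from \<open>n\<close> on has started, so the finite sum
    represents the curve near \<open>s\<close>.\<close>
  moreover have "open {s. s < 1 \<and> slot n s < 0}"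
    unfolding slot_def by (intro open_Collect_conj open_Collect_less continuous_intros)
  ultimately show ?thesis
    unfolding field
    by (rule has_vector_derivative_transform_within_open) (use n assms in \<open>auto simp: curve_eq_finite_sum[where n = n]\<close>)
qed

lemma is_solution_curve: "is_solution field (- \<infinity>) 0 (\<lambda>t. curve (exp t))"
  unfolding is_solution_def
proof (intro conjI ballI)
  fix t assume "t \<in> einterval (- \<infinity>) 0"
  then have t: "t < 0" by (simp add: einterval_def)
  have "((curve \<circ> exp) has_vector_derivative exp t *\<^sub>R ((1 / exp t) *\<^sub>R field (curve (exp t)))) (at t)"
    using t DERIV_exp[of t]
    by (intro vector_diff_chain_at curve_solves) (auto simp: has_real_derivative_iff_has_vector_derivative)
  then show "((\<lambda>t. curve (exp t)) has_vector_derivative field (curve (exp t))) (at t)"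
    by (simp add: o_def)
qed simp

section \<open>Maximality of the solution\<close>

lemma curve_no_limit:
  assumes lim: "(\<lambda>k. curve (1 - (1/2) ^ Suc k)) \<longlonglongrightarrow> l"
  shows False
proof -
  let ?s = "\<lambda>k. 1 - (1/2 :: real) ^ k"
  have slot: "slot k (?s k) = 0" for k by (simp add: slot_def power_divide)
  then have c: "curve (?s k) = ?s k *\<^sub>R unit_at 0 + unit_at (k + 1) + unit_at (k + 2)" for k
    using curve_in_slot[of "?s k" k] by (simp add: eq_0)
  obtain N where N: "\<And>k. k \<ge> N \<Longrightarrow> dist (curve (?s (Suc k))) l < 1/2"
    using metric_LIMSEQ_D[OF lim, of "1/2"] by auto
  \<comment> \<open>Snapshots two slots apart share only the clock vector, so they differ by 1 in
    coordinate \<open>N + 3\<close>, although both lie within 1/2 of the limit.\<close>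
  have "norm (curve (?s (Suc N)) - curve (?s (N + 3))) < 1"
    using N[of N] N[of "N + 2"] dist_triangle_half_l[of "curve (?s (Suc N))" l 1 "curve (?s (N + 3))"]
    by (simp add: dist_norm eval_nat_numeral)
  moreover have "coord (curve (?s (Suc N)) - curve (?s (N + 3))) (int (N + 3)) = 1"
    unfolding c by simp
  ultimately show False
    using abs_coord_le[of "curve (?s (Suc N)) - curve (?s (N + 3))" "int (N + 3)"] by simp
qed

text \<open>A strictly larger interval contains 0, where an extension would be continuous; the curve
  would then converge along the slot starts, against \<open>curve_no_limit\<close>.\<close>

lemma maximal_solution_curve: "maximal_solution field (- \<infinity>) 0 (\<lambda>t. curve (exp t))"
  unfolding maximal_solution_def
proof (intro conjI is_solution_curve notI)
  assume "\<exists>c d \<delta>. einterval (- \<infinity>) 0 \<subset> einterval c d \<and> is_solution field c d \<delta> \<and>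
    (\<forall>t\<in>einterval (- \<infinity>) 0. \<delta> t = curve (exp t))"
  then obtain c d \<delta> where sub: "einterval (- \<infinity>) 0 \<subset> einterval c d" and sol: "is_solution field c d \<delta>"
    and eq: "\<And>t. t < 0 \<Longrightarrow> \<delta> t = curve (exp t)"
    by (auto simp: einterval_def)
  obtain u where u: "u \<in> einterval c d" "u \<ge> 0"
    using sub by (force simp: einterval_def)
  have "-1 \<in> einterval c d" using sub by (force simp: einterval_def)
  then have "c < ereal (-1)" "ereal (-1) \<le> ereal 0" by (auto simp: einterval_def)
  then have "c < ereal 0" by (rule less_le_trans)
  moreover have "ereal 0 \<le> ereal u" "ereal u < d" using u by (auto simp: einterval_def)
  then have "ereal 0 < d" by (rule le_less_trans)
  ultimately have "0 \<in> einterval c d" by (simp add: einterval_def)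
  then have "isCont \<delta> 0"
    using sol unfolding is_solution_def by (blast intro: has_vector_derivative_continuous)
  \<comment> \<open>The times at which the slots start, increasing to 0; \<open>Suc k\<close> keeps
    the argument of \<open>ln\<close> positive at \<open>k = 0\<close>.\<close>
  moreover have "(\<lambda>k. ln (1 - (1/2 :: real) ^ Suc k)) \<longlonglongrightarrow> ln (1 - 0)"
    by (intro tendsto_intros LIMSEQ_Suc[OF LIMSEQ_power_zero]) auto
  ultimately have "(\<lambda>k. \<delta> (ln (1 - (1/2) ^ Suc k))) \<longlonglongrightarrow> \<delta> 0"
    using isCont_tendsto_compose by fastforce
  moreover have "\<delta> (ln (1 - (1/2) ^ Suc k)) = curve (1 - (1/2) ^ Suc k)" for k
  proof -
    have "(1/2 :: real) ^ Suc k < 1" by (rule power_Suc_less_one) auto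
    then show ?thesis by (subst eq) (simp_all add: ln_less_zero_iff)
  qed
  ultimately show False using curve_no_limit by simp
qed

end

theorem mainTheorem1:
  shows "\<exists>f :: int ell2 \<Rightarrow> int ell2. smooth_map f \<and>
           (\<exists>(a :: ereal) (b :: ereal) (\<gamma> :: real \<Rightarrow> int ell2).
              maximal_solution f a b \<gamma> \<and>
              bounded (\<gamma> ` einterval a b) \<and>
              einterval a b \<noteq> UNIV)"
proof -
  obtain G K where "smooth_step G K" using smooth_step_exists by blast
  then interpret smooth_step G K .
  have "bounded ((\<lambda>t. curve (exp t)) ` einterval (- \<infinity>) 0)"
    unfolding bounded_iff by (auto simp: einterval_def intro!: exI[of _ 5] norm_curve_le)
  moreover have "einterval (- \<infinity>) 0 \<noteq> UNIV"
    by (auto simp: einterval_def set_eq_iff intro!: exI[of _ 1])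
  ultimately show ?thesis
    using smooth_map_field maximal_solution_curve by blast
qed

end
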